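(* Let $G$ be a first-order structure expanding a group, $T$ its complete theory, and $\mathbb{G}$ a sufficiently saturated monster model of $T$. Let $\varphi(x)$ be a formula in one variable with parameters from $G$. (a) If $\varphi(x)$ is coheir substantial, then $\varphi(G)$ has the productset property. (b) If $T$ is stable, then $\varphi(x)$ is coheir substantial if and only if $\varphi(G)$ has the productset property.
   Context: $\varphi(x)$ is coheir substantial if there are $b,c\in\mathbb{G}\setminus G$ such that $\mathbb{G}\models\varphi(b\cdot c)$ and both $\mathrm{tp}(b/Gc)$ and $\mathrm{tp}(c/Gb)$ are finitely satisfiable in $G$ (every formula in them is satisfied by an element of $G$). A set $A\subseteq G$ has the productset property if there are infinite $B,C\subseteq G$ with $B\cdot C=\{b\cdot c:b\in B,c\in C\}\subseteq A$. *)

theory Defs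
  imports Main "HOL-Algebra.Group"
begin

unbundle cardinal_syntax

section \<open>First-order logic with parameters\<close>

record ('f, 'r) language =
  funs :: "'f set"
  rels :: "'r set"
  fun_arity :: "'f \<Rightarrow> nat"
  rel_arity :: "'r \<Rightarrow> nat"

text \<open>
  \<open>Par a\<close> is the constant naming the element \<open>a\<close>; it is interpreted by \<open>a\<close> itself.
  Formulas of the language \<open>L\<close> are those in which no \<open>Par\<close> occurs.
\<close>

datatype ('f, 'a) tm = Var nat | Par 'a | App 'f "('f, 'a) tm list"

datatype ('f, 'r, 'a) fm =
    Eq "('f, 'a) tm" "('f, 'a) tm"
  | Rel 'r "('f, 'a) tm list"
  | Neg "('f, 'r, 'a) fm"
  | Conj "('f, 'r, 'a) fm" "('f, 'r, 'a) fm"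
  | Ex nat "('f, 'r, 'a) fm"

fun tm_vars :: "('f, 'a) tm \<Rightarrow> nat set" where
  "tm_vars (Var n) = {n}"
| "tm_vars (Par a) = {}"
| "tm_vars (App f ts) = (\<Union>t\<in>set ts. tm_vars t)"

primrec free_vars :: "('f, 'r, 'a) fm \<Rightarrow> nat set" where
  "free_vars (Eq s t) = tm_vars s \<union> tm_vars t"
| "free_vars (Rel r ts) = (\<Union>t\<in>set ts. tm_vars t)"
| "free_vars (Neg \<phi>) = free_vars \<phi>"
| "free_vars (Conj \<phi> \<psi>) = free_vars \<phi> \<union> free_vars \<psi>"
| "free_vars (Ex n \<phi>) = free_vars \<phi> - {n}"

fun tm_over :: "('f, 'r) language \<Rightarrow> 'a set \<Rightarrow> ('f, 'a) tm \<Rightarrow> bool" where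
  "tm_over L A (Var n) \<longleftrightarrow> True"
| "tm_over L A (Par a) \<longleftrightarrow> a \<in> A"
| "tm_over L A (App f ts) \<longleftrightarrow>
     f \<in> funs L \<and> length ts = fun_arity L f \<and> (\<forall>t\<in>set ts. tm_over L A t)"

primrec fm_over :: "('f, 'r) language \<Rightarrow> 'a set \<Rightarrow> ('f, 'r, 'a) fm \<Rightarrow> bool" where
  "fm_over L A (Eq s t) \<longleftrightarrow> tm_over L A s \<and> tm_over L A t"
| "fm_over L A (Rel r ts) \<longleftrightarrow>
     r \<in> rels L \<and> length ts = rel_arity L r \<and> (\<forall>t\<in>set ts. tm_over L A t)"
| "fm_over L A (Neg \<phi>) \<longleftrightarrow> fm_over L A \<phi>"
| "fm_over L A (Conj \<phi> \<psi>) \<longleftrightarrow> fm_over L A \<phi> \<and> fm_over L A \<psi>"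
| "fm_over L A (Ex n \<phi>) \<longleftrightarrow> fm_over L A \<phi>"

record ('f, 'r, 'a) fo_struct =
  universe :: "'a set"
  fun_int :: "'f \<Rightarrow> 'a list \<Rightarrow> 'a"
  rel_int :: "'r \<Rightarrow> 'a list \<Rightarrow> bool"

definition is_struct :: "('f, 'r) language \<Rightarrow> ('f, 'r, 'a) fo_struct \<Rightarrow> bool" where
  "is_struct L M \<longleftrightarrow> universe M \<noteq> {} \<and>
     (\<forall>f\<in>funs L. \<forall>xs. length xs = fun_arity L f \<and> set xs \<subseteq> universe M \<longrightarrow>
        fun_int M f xs \<in> universe M)"

primrec tm_val :: "('f, 'r, 'a) fo_struct \<Rightarrow> (nat \<Rightarrow> 'a) \<Rightarrow> ('f, 'a) tm \<Rightarrow> 'a" where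
  "tm_val M e (Var n) = e n"
| "tm_val M e (Par a) = a"
| "tm_val M e (App f ts) = fun_int M f (map (tm_val M e) ts)"

primrec sat :: "('f, 'r, 'a) fo_struct \<Rightarrow> (nat \<Rightarrow> 'a) \<Rightarrow> ('f, 'r, 'a) fm \<Rightarrow> bool" where
  "sat M e (Eq s t) \<longleftrightarrow> tm_val M e s = tm_val M e t"
| "sat M e (Rel r ts) \<longleftrightarrow> rel_int M r (map (tm_val M e) ts)"
| "sat M e (Neg \<phi>) \<longleftrightarrow> \<not> sat M e \<phi>"
| "sat M e (Conj \<phi> \<psi>) \<longleftrightarrow> sat M e \<phi> \<and> sat M e \<psi>"
| "sat M e (Ex n \<phi>) \<longleftrightarrow> (\<exists>a\<in>universe M. sat M (e(n := a)) \<phi>)"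

definition elem_ext ::
    "('f, 'r) language \<Rightarrow> ('f, 'r, 'a) fo_struct \<Rightarrow> ('f, 'r, 'a) fo_struct \<Rightarrow> bool" where
  "elem_ext L G M \<longleftrightarrow> is_struct L G \<and> is_struct L M \<and> universe G \<subseteq> universe M \<and>
     (\<forall>\<phi> e. fm_over L (universe G) \<phi> \<and> range e \<subseteq> universe G \<longrightarrow> (sat G e \<phi> \<longleftrightarrow> sat M e \<phi>))"

text \<open>The satisfaction of a sentence does not depend on the assignment \<open>e\<close>.\<close>

definition Th :: "('f, 'r) language \<Rightarrow> ('f, 'r, 'a) fo_struct \<Rightarrow> ('f, 'r, 'a) fm set" where
  "Th L M = {\<phi>. fm_over L {} \<phi> \<and> free_vars \<phi> = {} \<and> (\<forall>e. sat M e \<phi>)}"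

definition is_model ::
    "('f, 'r) language \<Rightarrow> ('f, 'r, 'a) fo_struct \<Rightarrow> ('f, 'r, 'a) fm set \<Rightarrow> bool" where
  "is_model L M T \<longleftrightarrow> is_struct L M \<and> (\<forall>\<phi>\<in>T. \<forall>e. sat M e \<phi>)"


section \<open>Formulas in one variable, types, saturation\<close>

text \<open>The distinguished variable \<open>x\<close> is \<open>Var 0\<close>.\<close>

definition fm1 :: "('f, 'r) language \<Rightarrow> 'a set \<Rightarrow> ('f, 'r, 'a) fm set" where
  "fm1 L A = {\<phi>. fm_over L A \<phi> \<and> free_vars \<phi> \<subseteq> {0}}"

definition holds_at :: "('f, 'r, 'a) fo_struct \<Rightarrow> ('f, 'r, 'a) fm \<Rightarrow> 'a \<Rightarrow> bool" where
  "holds_at M \<phi> a \<longleftrightarrow> sat M (\<lambda>_. a) \<phi>"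

definition solutions :: "('f, 'r, 'a) fo_struct \<Rightarrow> ('f, 'r, 'a) fm \<Rightarrow> 'a set" where
  "solutions M \<phi> = {a \<in> universe M. holds_at M \<phi> a}"

definition tp ::
    "('f, 'r) language \<Rightarrow> ('f, 'r, 'a) fo_struct \<Rightarrow> 'a \<Rightarrow> 'a set \<Rightarrow> ('f, 'r, 'a) fm set" where
  "tp L M a A = {\<phi> \<in> fm1 L A. holds_at M \<phi> a}"

definition finitely_satisfiable_in ::
    "('f, 'r, 'a) fo_struct \<Rightarrow> ('f, 'r, 'a) fm set \<Rightarrow> 'a set \<Rightarrow> bool" where
  "finitely_satisfiable_in M p X \<longleftrightarrow> (\<forall>\<phi>\<in>p. \<exists>a\<in>X. holds_at M \<phi> a)"

definition saturated ::
    "'k rel \<Rightarrow> ('f, 'r) language \<Rightarrow> ('f, 'r, 'a) fo_struct \<Rightarrow> bool" where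
  "saturated \<kappa> L M \<longleftrightarrow>
     (\<forall>A p. A \<subseteq> universe M \<and> |A| <o \<kappa> \<and> p \<subseteq> fm1 L A \<and>
        (\<forall>q. finite q \<and> q \<subseteq> p \<longrightarrow> (\<exists>a\<in>universe M. \<forall>\<phi>\<in>q. holds_at M \<phi> a)) \<longrightarrow>
        (\<exists>a\<in>universe M. \<forall>\<phi>\<in>p. holds_at M \<phi> a))"


section \<open>Stability\<close>

text \<open>
  The order property of \<open>\<phi>(x, y)\<close> in \<open>N\<close>, where \<open>x\<close> and \<open>y\<close> are the tuples of variables
  \<open>0, ..., k - 1\<close> and \<open>k, ..., k + l - 1\<close>.
\<close>

definition order_property ::
    "('f, 'r, 'a) fo_struct \<Rightarrow> ('f, 'r, 'a) fm \<Rightarrow> nat \<Rightarrow> nat \<Rightarrow> bool" where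
  "order_property N \<phi> k l \<longleftrightarrow>
     (\<exists>a b :: nat \<Rightarrow> 'a list.
        (\<forall>i. length (a i) = k \<and> set (a i) \<subseteq> universe N) \<and>
        (\<forall>i. length (b i) = l \<and> set (b i) \<subseteq> universe N) \<and>
        (\<forall>i j. sat N (nth (a i @ b j)) \<phi> \<longleftrightarrow> i < j))"

text \<open>
  No formula has the order property in a model of \<open>T\<close>. The models range over structures on
  subsets of the type \<open>'a\<close>; this loses nothing for complete \<open>T\<close> as soon as \<open>T\<close> has a finite
  or an \<open>\<aleph>\<^sub>1\<close>-saturated model on a subset of \<open>'a\<close>, because, by compactness, the order
  property then appears in that model if it appears in any model of \<open>T\<close> at all.
\<close>

definition stable_theory :: "('f, 'r) language \<Rightarrow> ('f, 'r, 'a) fm set \<Rightarrow> bool" where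
  "stable_theory L T \<longleftrightarrow>
     (\<forall>(N :: ('f, 'r, 'a) fo_struct) \<phi> k l.
        is_model L N T \<and> fm_over L {} \<phi> \<and> free_vars \<phi> \<subseteq> {..<k + l} \<longrightarrow>
        \<not> order_property N \<phi> k l)"


section \<open>Expansions of groups\<close>

abbreviation gmult :: "('f, 'r, 'a) fo_struct \<Rightarrow> 'f \<Rightarrow> 'a \<Rightarrow> 'a \<Rightarrow> 'a" where
  "gmult M m x y \<equiv> fun_int M m [x, y]"

text \<open>
  Only the multiplication \<open>m\<close> is required to be a symbol of \<open>L\<close>; the unit and the inverse may
  or may not be named as well.
\<close>

definition expands_group :: "('f, 'r) language \<Rightarrow> 'f \<Rightarrow> ('f, 'r, 'a) fo_struct \<Rightarrow> bool" where
  "expands_group L m G \<longleftrightarrow> is_struct L G \<and> m \<in> funs L \<and> fun_arity L m = 2 \<and>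
     (\<exists>u. group \<lparr>carrier = universe G, mult = gmult G m, one = u\<rparr>)"

definition coheir_substantial ::
    "('f, 'r) language \<Rightarrow> 'f \<Rightarrow> ('f, 'r, 'a) fo_struct \<Rightarrow> ('f, 'r, 'a) fo_struct \<Rightarrow>
     ('f, 'r, 'a) fm \<Rightarrow> bool" where
  "coheir_substantial L m G M \<phi> \<longleftrightarrow>
     (\<exists>b\<in>universe M - universe G. \<exists>c\<in>universe M - universe G.
        holds_at M \<phi> (gmult M m b c) \<and>
        finitely_satisfiable_in M (tp L M b (insert c (universe G))) (universe G) \<and>
        finitely_satisfiable_in M (tp L M c (insert b (universe G))) (universe G))"

definition productset_property :: "'f \<Rightarrow> ('f, 'r, 'a) fo_struct \<Rightarrow> 'a set \<Rightarrow> bool" where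
  "productset_property m G A \<longleftrightarrow>
     (\<exists>B C. B \<subseteq> universe G \<and> C \<subseteq> universe G \<and> infinite B \<and> infinite C \<and>
        {gmult G m b c |b c. b \<in> B \<and> c \<in> C} \<subseteq> A)"

end

theory Submission
  imports Defs
begin

text \<open>
  If \<open>b\<close>, \<open>c\<close> witness coheir substantiality, choose \<open>b\<^sub>n\<close>, \<open>c\<^sub>n\<close> in \<open>G\<close> alternately: \<open>b\<^sub>n\<close> imitates
  \<open>b\<close> with respect to \<open>c\<close> and the earlier \<open>c\<^sub>j\<close>, and \<open>c\<^sub>n\<close> imitates \<open>c\<close> with respect to \<open>b\<close> and
  the \<open>b\<^sub>i\<close> chosen so far. Conversely, given infinite \<open>B\<close>, \<open>C\<close> with \<open>B \<cdot> C \<subseteq> \<phi>(G)\<close>, saturation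
  yields \<open>b\<close> satisfying all formulas over \<open>G\<close> that hold almost everywhere on \<open>B\<close>, and then \<open>c\<close>
  satisfying all formulas over \<open>G b\<close> that hold almost everywhere on \<open>C\<close>. So \<open>\<phi>(b \<cdot> c)\<close> holds and
  \<open>tp(c/Gb)\<close> is finitely satisfiable in \<open>G\<close>; stability gives the same for \<open>tp(b/Gc)\<close>.
\<close>

section \<open>Renaming variables and replacing parameters\<close>

primrec tr_tm :: "(nat \<Rightarrow> nat) \<Rightarrow> ('a \<Rightarrow> ('f, 'a) tm) \<Rightarrow> ('f, 'a) tm \<Rightarrow> ('f, 'a) tm" where
  "tr_tm \<rho> \<sigma> (Var n) = Var (\<rho> n)"
| "tr_tm \<rho> \<sigma> (Par a) = \<sigma> a"
| "tr_tm \<rho> \<sigma> (App f ts) = App f (map (tr_tm \<rho> \<sigma>) ts)"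

text \<open>Bound variables are renamed along with the free ones and nothing guards against capture;
  \<open>sat_tr\<close> gives conditions under which satisfaction is still controlled. With the
  identity renaming and terms \<open>Par\<close>, this only exchanges parameters.\<close>

primrec tr :: "(nat \<Rightarrow> nat) \<Rightarrow> ('a \<Rightarrow> ('f, 'a) tm) \<Rightarrow> ('f, 'r, 'a) fm \<Rightarrow> ('f, 'r, 'a) fm" where
  "tr \<rho> \<sigma> (Eq s t) = Eq (tr_tm \<rho> \<sigma> s) (tr_tm \<rho> \<sigma> t)"
| "tr \<rho> \<sigma> (Rel r ts) = Rel r (map (tr_tm \<rho> \<sigma>) ts)"
| "tr \<rho> \<sigma> (Neg \<phi>) = Neg (tr \<rho> \<sigma> \<phi>)"
| "tr \<rho> \<sigma> (Conj \<phi> \<psi>) = Conj (tr \<rho> \<sigma> \<phi>) (tr \<rho> \<sigma> \<psi>)"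
| "tr \<rho> \<sigma> (Ex n \<phi>) = Ex (\<rho> n) (tr \<rho> \<sigma> \<phi>)"

lemma tm_val_cong: "(\<And>n. n \<in> tm_vars t \<Longrightarrow> e n = e' n) \<Longrightarrow> tm_val M e t = tm_val M e' t"
proof (induction t)
  case (App f ts)
  then have "map (tm_val M e) ts = map (tm_val M e') ts"
    by (auto intro!: App.IH)
  then show ?case by (simp del: map_eq_conv)
qed auto

lemma sat_cong: "(\<And>n. n \<in> free_vars \<phi> \<Longrightarrow> e n = e' n) \<Longrightarrow> sat M e \<phi> \<longleftrightarrow> sat M e' \<phi>"
proof (induction \<phi> arbitrary: e e')
  case (Eq s t)
  then show ?case using tm_val_cong[of s e e' M] tm_val_cong[of t e e' M] by auto
next
  case (Rel r ts)
  then have "map (tm_val M e) ts = map (tm_val M e') ts"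
    by (auto intro!: tm_val_cong)
  then show ?case by (simp del: map_eq_conv)
next
  case (Neg \<phi>)
  then have "sat M e \<phi> \<longleftrightarrow> sat M e' \<phi>"
    by (intro Neg.IH) auto
  then show ?case by simp
next
  case (Conj \<phi> \<psi>)
  have "sat M e \<phi> \<longleftrightarrow> sat M e' \<phi>"
    using Conj.prems by (intro Conj.IH(1)) simp
  moreover have "sat M e \<psi> \<longleftrightarrow> sat M e' \<psi>"
    using Conj.prems by (intro Conj.IH(2)) simp
  ultimately show ?case by simp
next
  case (Ex n \<phi>)
  then have "sat M (e(n := a)) \<phi> \<longleftrightarrow> sat M (e'(n := a)) \<phi>" for a
    by (intro Ex.IH) auto
  then show ?case by simp
qed

lemma tm_over_mono: "tm_over L A t \<Longrightarrow> A \<subseteq> B \<Longrightarrow> tm_over L B t"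
  by (induction t) auto

lemma fm_over_mono: "fm_over L A \<phi> \<Longrightarrow> A \<subseteq> B \<Longrightarrow> fm_over L B \<phi>"
  by (induction \<phi>) (auto intro: tm_over_mono)

lemma tms_over_finite:
  assumes "\<And>t. t \<in> set ts \<Longrightarrow> \<exists>F. finite F \<and> F \<subseteq> A \<and> tm_over L F t"
  shows "\<exists>F. finite F \<and> F \<subseteq> A \<and> (\<forall>t\<in>set ts. tm_over L F t)"
proof -
  obtain F where F: "\<And>t. t \<in> set ts \<Longrightarrow> finite (F t) \<and> F t \<subseteq> A \<and> tm_over L (F t) t"
    using assms by metis
  then have "\<forall>t\<in>set ts. tm_over L (\<Union> (F ` set ts)) t"
    by (meson UN_upper tm_over_mono)
  then show ?thesis
    using F by (intro exI[of _ "\<Union> (F ` set ts)"]) auto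
qed

lemma tm_over_finite: "tm_over L A t \<Longrightarrow> \<exists>F. finite F \<and> F \<subseteq> A \<and> tm_over L F t"
proof (induction t)
  case (Par a)
  then show ?case by (intro exI[of _ "{a}"]) auto
next
  case (App f ts)
  then show ?case using tms_over_finite[of ts A L] by auto
qed auto

text \<open>This allows the parameters of a formula to be listed as a tuple and traded for
  variables.\<close>

lemma fm_over_finite: "fm_over L A \<phi> \<Longrightarrow> \<exists>F. finite F \<and> F \<subseteq> A \<and> fm_over L F \<phi>"
proof (induction \<phi>)
  case (Eq s t)
  then have "\<exists>F. finite F \<and> F \<subseteq> A \<and> tm_over L F u" if "u \<in> set [s, t]" for u
    using that by (intro tm_over_finite) auto
  then show ?case
    using tms_over_finite[of "[s, t]" A L] by simp
next
  case (Rel r ts)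
  then have "\<exists>F. finite F \<and> F \<subseteq> A \<and> tm_over L F u" if "u \<in> set ts" for u
    using that by (intro tm_over_finite) auto
  then show ?case
    using tms_over_finite[of ts A L] Rel.prems by simp
next
  case (Conj \<phi> \<psi>)
  then obtain F F' where "finite F" "F \<subseteq> A" "fm_over L F \<phi>" "finite F'" "F' \<subseteq> A" "fm_over L F' \<psi>"
    by auto
  then show ?case
    by (intro exI[of _ "F \<union> F'"]) (auto intro: fm_over_mono)
qed auto

lemma tm_over_tr:
  "tm_over L A t \<Longrightarrow> (\<And>p. p \<in> A \<Longrightarrow> tm_over L B (\<sigma> p)) \<Longrightarrow> tm_over L B (tr_tm \<rho> \<sigma> t)"
  by (induction t) auto

lemma fm_over_tr:
  "fm_over L A \<phi> \<Longrightarrow> (\<And>p. p \<in> A \<Longrightarrow> tm_over L B (\<sigma> p)) \<Longrightarrow> fm_over L B (tr \<rho> \<sigma> \<phi>)"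
  by (induction \<phi>) (auto intro: tm_over_tr)

lemma tm_vars_tr:
  "tm_over L A t \<Longrightarrow> tm_vars (tr_tm \<rho> \<sigma> t) \<subseteq> \<rho> ` tm_vars t \<union> (\<Union>p\<in>A. tm_vars (\<sigma> p))"
  by (induction t) fastforce+

lemma free_vars_tr:
  "fm_over L A \<phi> \<Longrightarrow> free_vars (tr \<rho> \<sigma> \<phi>) \<subseteq> \<rho> ` free_vars \<phi> \<union> (\<Union>p\<in>A. tm_vars (\<sigma> p))"
proof (induction \<phi>)
  case (Eq s t)
  then show ?case using tm_vars_tr[of L A s \<rho> \<sigma>] tm_vars_tr[of L A t \<rho> \<sigma>] by auto
next
  case (Rel r ts)
  then have "\<forall>t\<in>set ts. tm_vars (tr_tm \<rho> \<sigma> t) \<subseteq> \<rho> ` tm_vars t \<union> (\<Union>p\<in>A. tm_vars (\<sigma> p))"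
    by (intro ballI tm_vars_tr) auto
  then show ?case by (simp add: image_UN) blast
qed auto

lemma tr_tm_cong:
  "tm_over L A t \<Longrightarrow> (\<And>p. p \<in> A \<Longrightarrow> \<sigma> p = \<sigma>' p) \<Longrightarrow> tr_tm \<rho> \<sigma> t = tr_tm \<rho> \<sigma>' t"
  by (induction t) auto

lemma tr_cong:
  "fm_over L A \<phi> \<Longrightarrow> (\<And>p. p \<in> A \<Longrightarrow> \<sigma> p = \<sigma>' p) \<Longrightarrow> tr \<rho> \<sigma> \<phi> = tr \<rho> \<sigma>' \<phi>"
  by (induction \<phi>) (auto intro: tr_tm_cong)

lemma tr_tm_id [simp]: "tr_tm (\<lambda>n. n) Par t = t"
  by (induction t) (auto intro: map_idI)

lemma tr_id [simp]: "tr (\<lambda>n. n) Par \<phi> = \<phi>"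
  by (induction \<phi>) (auto intro: map_idI)

lemma tm_val_tr:
  "tm_val M e (tr_tm \<rho> \<sigma> t) = tm_val M (\<lambda>n. e (\<rho> n)) (tr_tm (\<lambda>n. n) (\<lambda>p. Par (tm_val M e (\<sigma> p))) t)"
  by (induction t) (auto cong: map_cong)

text \<open>By injectivity, quantifying over \<open>\<rho> n\<close> changes the pulled back
  assignment at \<open>n\<close> only. Since the terms \<open>\<sigma> p\<close> avoid the range of
  \<open>\<rho>\<close>, no quantifier captures them, and they can be replaced by parameters naming
  their values.\<close>

lemma sat_tr:
  assumes "inj \<rho>"
  shows "fm_over L A \<phi> \<Longrightarrow> (\<And>p. p \<in> A \<Longrightarrow> tm_vars (\<sigma> p) \<inter> range \<rho> = {}) \<Longrightarrow>
    sat M e (tr \<rho> \<sigma> \<phi>) \<longleftrightarrow> sat M (\<lambda>n. e (\<rho> n)) (tr (\<lambda>n. n) (\<lambda>p. Par (tm_val M e (\<sigma> p))) \<phi>)"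
proof (induction \<phi> arbitrary: e)
  case (Eq s t)
  then show ?case using tm_val_tr[of M e \<rho> \<sigma>] by simp
next
  case (Rel r ts)
  have "map (tm_val M e) (map (tr_tm \<rho> \<sigma>) ts) =
      map (tm_val M (\<lambda>n. e (\<rho> n))) (map (tr_tm (\<lambda>n. n) (\<lambda>p. Par (tm_val M e (\<sigma> p)))) ts)"
    using tm_val_tr[of M e \<rho> \<sigma>] by simp
  then show ?case by (simp del: map_eq_conv map_map)
next
  case (Ex n \<phi>)
  have "sat M (e(\<rho> n := a)) (tr \<rho> \<sigma> \<phi>) \<longleftrightarrow>
      sat M ((\<lambda>n. e (\<rho> n))(n := a)) (tr (\<lambda>n. n) (\<lambda>p. Par (tm_val M e (\<sigma> p))) \<phi>)" for a
  proof -
    have "sat M (e(\<rho> n := a)) (tr \<rho> \<sigma> \<phi>) \<longleftrightarrow> sat M (\<lambda>k. (e(\<rho> n := a)) (\<rho> k))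
        (tr (\<lambda>n. n) (\<lambda>p. Par (tm_val M (e(\<rho> n := a)) (\<sigma> p))) \<phi>)"
      using Ex.prems by (intro Ex.IH) auto
    also have "(\<lambda>k. (e(\<rho> n := a)) (\<rho> k)) = (\<lambda>n. e (\<rho> n))(n := a)"
      using assms by (auto simp: fun_eq_iff inj_eq)
    also have "tr (\<lambda>n. n) (\<lambda>p. Par (tm_val M (e(\<rho> n := a)) (\<sigma> p))) \<phi> =
        tr (\<lambda>n. n) (\<lambda>p. Par (tm_val M e (\<sigma> p))) \<phi>"
      using Ex.prems by (intro tr_cong[of L A]) (fastforce intro!: tm_val_cong)+
    finally show ?thesis .
  qed
  then show ?case by simp
qed auto

text \<open>
  Substitutes \<open>t\<close> for the distinguished variable; shifting the variables of \<open>\<theta>\<close> keeps its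
  quantifiers from capturing the variable of \<open>t\<close> and of the terms \<open>\<sigma> p\<close>.
\<close>

definition plug ::
    "('f, 'a) tm \<Rightarrow> ('a \<Rightarrow> ('f, 'a) tm) \<Rightarrow> ('f, 'r, 'a) fm \<Rightarrow> ('f, 'r, 'a) fm" where
  "plug t \<sigma> \<theta> = Ex 1 (Conj (Eq (Var 1) t) (tr Suc \<sigma> \<theta>))"

lemma plug_in_fm1:
  assumes "\<theta> \<in> fm1 L A" "tm_over L B t" "tm_vars t \<subseteq> {0}"
    and "\<And>p. p \<in> A \<Longrightarrow> tm_over L B (\<sigma> p) \<and> tm_vars (\<sigma> p) \<subseteq> {0}"
  shows "plug t \<sigma> \<theta> \<in> fm1 L B"
proof -
  have "fm_over L B (tr Suc \<sigma> \<theta>)"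
    using assms by (auto simp: fm1_def intro: fm_over_tr)
  moreover have "free_vars (tr Suc \<sigma> \<theta>) \<subseteq> {0, 1}"
  proof -
    have "fm_over L A \<theta>" and "Suc ` free_vars \<theta> \<subseteq> {0, 1}"
      using assms(1) by (auto simp: fm1_def)
    moreover have "(\<Union>p\<in>A. tm_vars (\<sigma> p)) \<subseteq> {0, 1}"
      using assms(4) by blast
    ultimately show ?thesis
      using free_vars_tr[of L A \<theta> Suc \<sigma>] by blast
  qed
  ultimately show ?thesis
    using assms(2,3) by (auto simp: plug_def fm1_def)
qed

text \<open>The equation in \<open>plug\<close> forces the quantified \<open>Var 1\<close> to be the
  value of \<open>t\<close>, which must lie in the universe to be a witness. After the shift,
  \<open>Var 1\<close> is the distinguished variable of \<open>\<theta>\<close>, while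
  \<open>Var 0\<close>, the variable of the terms \<open>\<sigma> p\<close>, keeps the value
  \<open>y\<close>.\<close>

lemma holds_at_plug:
  assumes "\<theta> \<in> fm1 L A" "tm_vars t \<subseteq> {0}" "tm_val M (\<lambda>_. y) t \<in> universe M"
    and \<sigma>: "\<And>p. p \<in> A \<Longrightarrow> tm_vars (\<sigma> p) \<subseteq> {0}"
  shows "holds_at M (plug t \<sigma> \<theta>) y \<longleftrightarrow>
    holds_at M (tr (\<lambda>n. n) (\<lambda>p. Par (tm_val M (\<lambda>_. y) (\<sigma> p))) \<theta>) (tm_val M (\<lambda>_. y) t)"
proof -
  let ?e = "\<lambda>a. (\<lambda>_. y)(Suc 0 := a)" and ?h = "\<lambda>p. Par (tm_val M (\<lambda>_. y) (\<sigma> p))"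
  have \<theta>: "fm_over L A \<theta>" "free_vars \<theta> \<subseteq> {0}"
    using assms(1) by (auto simp: fm1_def)
  have "tm_val M (?e a) t = tm_val M (\<lambda>_. y) t" for a
    using assms(2) by (intro tm_val_cong) auto
  moreover have "sat M (?e a) (tr Suc \<sigma> \<theta>) \<longleftrightarrow> holds_at M (tr (\<lambda>n. n) ?h \<theta>) a" for a
  proof -
    have "sat M (?e a) (tr Suc \<sigma> \<theta>) \<longleftrightarrow>
        sat M (\<lambda>n. ?e a (Suc n)) (tr (\<lambda>n. n) (\<lambda>p. Par (tm_val M (?e a) (\<sigma> p))) \<theta>)"
      using \<theta>(1) \<sigma> by (intro sat_tr) fastforce+
    also have "tr (\<lambda>n. n) (\<lambda>p. Par (tm_val M (?e a) (\<sigma> p))) \<theta> = tr (\<lambda>n. n) ?h \<theta>"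
      using \<theta>(1) \<sigma> by (intro tr_cong[of L A]) (fastforce intro!: tm_val_cong)+
    also have "sat M (\<lambda>n. ?e a (Suc n)) (tr (\<lambda>n. n) ?h \<theta>) \<longleftrightarrow> sat M (\<lambda>_. a) (tr (\<lambda>n. n) ?h \<theta>)"
      using \<theta> free_vars_tr[of L A \<theta> "\<lambda>n. n" ?h] by (intro sat_cong) auto
    finally show ?thesis unfolding holds_at_def .
  qed
  ultimately show ?thesis
    using assms(3) by (auto simp: plug_def holds_at_def[of M "Ex _ _"])
qed


section \<open>Finite satisfiability\<close>

lemma finite_conjunction:
  assumes "finite S" "S \<subseteq> fm1 L A"
  shows "\<exists>\<chi>\<in>fm1 L A. \<forall>a. holds_at M \<chi> a \<longleftrightarrow> (\<forall>\<psi>\<in>S. holds_at M \<psi> a)"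
  using assms
proof (induction S rule: finite_induct)
  case empty
  \<comment> \<open>A tautology stands for the empty conjunction.\<close>
  show ?case
    by (rule bexI[of _ "Eq (Var 0) (Var 0)"]) (auto simp: fm1_def holds_at_def)
next
  case (insert \<psi> S)
  then obtain \<chi> where "\<chi> \<in> fm1 L A" "\<forall>a. holds_at M \<chi> a \<longleftrightarrow> (\<forall>\<psi>\<in>S. holds_at M \<psi> a)"
    by auto
  with insert.prems show ?case
    by (intro bexI[of _ "Conj \<psi> \<chi>"]) (auto simp: fm1_def holds_at_def)
qed

lemma neq_in_fm1 [simp]: "Neg (Eq (Var 0) (Par g)) \<in> fm1 L A \<longleftrightarrow> g \<in> A"
  by (simp add: fm1_def)

lemma holds_at_neq [simp]: "holds_at M (Neg (Eq (Var 0) (Par g))) a \<longleftrightarrow> a \<noteq> g"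
  by (simp add: holds_at_def)

text \<open>The type of \<open>b\<close> is closed under finite conjunctions and, because
  \<open>b\<close> is outside \<open>U\<close>, contains the inequalities with the elements of
  \<open>X\<close> in \<open>U\<close>. The freshness of the solution later makes the sequences
  injective.\<close>

lemma finitely_satisfiable_tpD:
  assumes "finitely_satisfiable_in M (tp L M b A) U" "b \<notin> U" "U \<subseteq> A"
    and "finite S" "S \<subseteq> fm1 L A" "\<forall>\<psi>\<in>S. holds_at M \<psi> b" "finite X"
  shows "\<exists>a\<in>U - X. \<forall>\<psi>\<in>S. holds_at M \<psi> a"
proof -
  let ?S = "S \<union> (\<lambda>g. Neg (Eq (Var 0) (Par g))) ` (X \<inter> U)"
  have "finite ?S" "?S \<subseteq> fm1 L A"
    using assms by auto
  then obtain \<chi> where \<chi>: "\<chi> \<in> fm1 L A" "\<And>a. holds_at M \<chi> a \<longleftrightarrow> (\<forall>\<psi>\<in>?S. holds_at M \<psi> a)"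
    using finite_conjunction[of ?S L A M] by blast
  have "\<chi> \<in> tp L M b A"
    using assms \<chi> by (auto simp: tp_def)
  then obtain a where "a \<in> U" "holds_at M \<chi> a"
    using assms(1) by (auto simp: finitely_satisfiable_in_def)
  moreover from this \<chi>(2)[of a] have *: "\<forall>\<psi>\<in>?S. holds_at M \<psi> a"
    by simp
  moreover have "a \<noteq> g" if "g \<in> X \<inter> U" for g
    using * that holds_at_neq[of M g a] by blast
  ultimately show ?thesis by blast
qed

lemma elem_ext_holds_at:
  assumes "elem_ext L G M" "\<psi> \<in> fm1 L (universe G)" "a \<in> universe G"
  shows "holds_at G \<psi> a \<longleftrightarrow> holds_at M \<psi> a"
  using assms by (auto simp: elem_ext_def fm1_def holds_at_def)

text \<open>As in the Tarski-Vaught test: \<open>Ex 0 \<psi>\<close> is true in \<open>M\<close>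
  because of \<open>b\<close>, hence true in \<open>G\<close>.\<close>

lemma elem_ext_finitely_satisfiable:
  assumes "elem_ext L G M" "b \<in> universe M"
  shows "finitely_satisfiable_in M (tp L M b (universe G)) (universe G)"
  unfolding finitely_satisfiable_in_def
proof
  fix \<psi> assume "\<psi> \<in> tp L M b (universe G)"
  then have \<psi>: "\<psi> \<in> fm1 L (universe G)" "holds_at M \<psi> b"
    by (auto simp: tp_def)
  obtain g where g: "g \<in> universe G"
    using assms(1) by (auto simp: elem_ext_def is_struct_def)
  have *: "sat N ((\<lambda>_. g)(0 := a)) \<psi> \<longleftrightarrow> holds_at N \<psi> a" for N :: "('a, 'b, 'c) fo_struct" and a
    using \<psi>(1) unfolding holds_at_def by (intro sat_cong) (auto simp: fm1_def)
  have "sat G (\<lambda>_. g) (Ex 0 \<psi>) \<longleftrightarrow> sat M (\<lambda>_. g) (Ex 0 \<psi>)"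
    using assms(1) \<psi>(1) g unfolding elem_ext_def fm1_def
    by (metis (no_types, lifting) fm_over.simps(5) image_subsetI mem_Collect_eq)
  moreover have "sat M (\<lambda>_. g) (Ex 0 \<psi>)"
    using assms(2) \<psi>(2) * by auto
  ultimately obtain a where "a \<in> universe G" "holds_at G \<psi> a"
    using * by auto
  then show "\<exists>a\<in>universe G. holds_at M \<psi> a"
    using elem_ext_holds_at[OF assms(1) \<psi>(1)] by auto
qed

text \<open>In round \<open>n\<close>, first \<open>x n\<close> is chosen against the earlier
  \<open>y j\<close>, then \<open>y n\<close> against all \<open>x i\<close> with
  \<open>i \<le> n\<close>. Two relations cover two uses: for product sets they coincide, for the
  order property one is the negation of the other.\<close>

lemma alternating_sequences:
  fixes U :: "'u set" and V :: "'v set"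
  assumes stepx: "\<And>X Y. finite X \<Longrightarrow> finite Y \<Longrightarrow> X \<subseteq> U \<Longrightarrow> Y \<subseteq> V \<Longrightarrow> \<exists>x\<in>U - X. \<forall>y\<in>Y. R x y"
    and stepy: "\<And>X Y. finite X \<Longrightarrow> finite Y \<Longrightarrow> X \<subseteq> U \<Longrightarrow> Y \<subseteq> V \<Longrightarrow> \<exists>y\<in>V - Y. \<forall>x\<in>X. S x y"
  shows "\<exists>x y :: nat \<Rightarrow> _. range x \<subseteq> U \<and> range y \<subseteq> V \<and> inj x \<and> inj y \<and>
    (\<forall>i j. j < i \<longrightarrow> R (x i) (y j)) \<and> (\<forall>i j. i \<le> j \<longrightarrow> S (x i) (y j))"
proof -
  \<comment> \<open>\<open>P f n r\<close> says that the pair \<open>r\<close> is a legal round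
    \<open>n\<close> after the earlier rounds recorded in \<open>f\<close>. Inserting
    \<open>fst r\<close> gives \<open>S\<close> on the diagonal too.\<close>
  define P where "P = (\<lambda>f (n :: nat) r.
    fst r \<in> U - fst ` f ` {..<n} \<and> (\<forall>y\<in>snd ` f ` {..<n}. R (fst r) y) \<and>
    snd r \<in> V - snd ` f ` {..<n} \<and> (\<forall>x\<in>insert (fst r) (fst ` f ` {..<n}). S x (snd r)))"
  have "\<exists>f. \<forall>n. P f n (f n)"
  proof (rule dependent_wellorder_choice)
    fix r n and f g :: "nat \<Rightarrow> 'u \<times> 'v" assume "\<And>i. i < n \<Longrightarrow> f i = g i"
    then have "f ` {..<n} = g ` {..<n}" by auto
    then show "P f n r = P g n r" by (simp only: P_def)
  next
    fix n and f :: "nat \<Rightarrow> 'u \<times> 'v" assume f: "\<And>i. i < n \<Longrightarrow> P f i (f i)"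
    let ?X = "fst ` f ` {..<n}" and ?Y = "snd ` f ` {..<n}"
    have XY: "?X \<subseteq> U" "?Y \<subseteq> V"
      using f by (auto simp: P_def)
    obtain x where x: "x \<in> U - ?X" "\<forall>y\<in>?Y. R x y"
      using stepx[of ?X ?Y] XY by auto
    obtain y where "y \<in> V - ?Y" "\<forall>x\<in>insert x ?X. S x y"
      using stepy[of "insert x ?X" ?Y] XY x by auto
    with x have "P f n (x, y)"
      by (simp add: P_def)
    then show "\<exists>r. P f n r" ..
  qed
  then obtain f where f: "\<And>n. P f n (f n)" by blast
  show ?thesis
  proof (intro exI conjI)
    show "range (fst \<circ> f) \<subseteq> U" "range (snd \<circ> f) \<subseteq> V"
      using f by (auto simp: P_def)
    have "(fst \<circ> f) i \<noteq> (fst \<circ> f) j \<and> (snd \<circ> f) i \<noteq> (snd \<circ> f) j" if "i < j" for i j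
    proof -
      have "f i \<in> f ` {..<j}"
        using that by simp
      then show ?thesis
        using f[of j] unfolding P_def o_def by (metis DiffD2 imageI)
    qed
    then show "inj (fst \<circ> f)" "inj (snd \<circ> f)"
      by (auto intro!: linorder_injI)
    show "\<forall>i j. j < i \<longrightarrow> R ((fst \<circ> f) i) ((snd \<circ> f) j)"
      using f by (auto simp: P_def)
    show "\<forall>i j. i \<le> j \<longrightarrow> S ((fst \<circ> f) i) ((snd \<circ> f) j)"
      using f by (auto simp: P_def le_less)
  qed
qed


section \<open>Coheirs in stable theories\<close>

text \<open>
  Symmetry: if \<open>\<theta>(b, c)\<close> holds but \<open>\<theta>(a, c)\<close> fails for all \<open>a\<close> in \<open>G\<close>, choose alternately
  \<open>c\<^sub>n\<close> satisfying \<open>\<theta>(b, y)\<close> and \<open>\<not> \<theta>(a\<^sub>i, y)\<close> for \<open>i < n\<close>, and \<open>a\<^sub>n\<close> satisfying \<open>\<theta>(x, c\<^sub>j)\<close>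
  for \<open>j \<le> n\<close>. Then \<open>\<theta>(a\<^sub>i, c\<^sub>j)\<close> is equivalent to \<open>j \<le> i\<close>.
\<close>

lemma stable_coheir_symmetric:
  fixes G M :: "('f, 'r, 'a) fo_struct"
  assumes GM: "elem_ext L G M" and stable: "stable_theory L (Th L G)"
    and b: "b \<in> universe M - universe G" and c: "c \<in> universe M - universe G"
    and fs: "finitely_satisfiable_in M (tp L M c (insert b (universe G))) (universe G)"
  shows "finitely_satisfiable_in M (tp L M b (insert c (universe G))) (universe G)"
proof (rule ccontr)
  let ?G = "universe G"
  assume "\<not> ?thesis"
  then obtain \<theta> where \<theta>: "\<theta> \<in> fm1 L (insert c ?G)" "holds_at M \<theta> b"
    and no: "\<And>a. a \<in> ?G \<Longrightarrow> \<not> holds_at M \<theta> a"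
    by (auto simp: finitely_satisfiable_in_def tp_def)
  have GsubM: "?G \<subseteq> universe M" and struct: "is_struct L G"
    using GM by (auto simp: elem_ext_def)
  \<comment> \<open>With \<open>\<theta>\<close> read as a relation between \<open>x\<close> and
    \<open>c\<close>, \<open>at y\<close> puts \<open>y\<close> for \<open>c\<close>, whereas
    \<open>swap a\<close> puts \<open>a\<close> for \<open>x\<close> and makes the place of
    \<open>c\<close> the variable.\<close>
  define at where "at y = tr (\<lambda>n. n) (\<lambda>p. Par (if p = c then y else p)) \<theta>" for y
  define swap where "swap a = plug (Par a) (Par(c := Var 0)) \<theta>" for a
  have "(\<lambda>p. Par (if p = c then c else p) :: ('f, 'a) tm) = Par"
    by auto
  then have at_c: "at c = \<theta>"
    by (simp only: at_def tr_id)
  have at_fm1: "at y \<in> fm1 L ?G" if "y \<in> ?G" for y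
    using \<theta>(1) that free_vars_tr[of L "insert c ?G" \<theta> "\<lambda>n. n" "\<lambda>p. Par (if p = c then y else p)"]
    unfolding at_def fm1_def by (auto intro!: fm_over_tr split: if_splits)
  have swap_fm1: "swap a \<in> fm1 L (insert a ?G)" for a
    unfolding swap_def by (rule plug_in_fm1[OF \<theta>(1)]) auto
  have swap: "holds_at M (swap a) y \<longleftrightarrow> holds_at M (at y) a" if "a \<in> universe M" for a y
  proof -
    have "(\<lambda>p. Par (tm_val M (\<lambda>_. y) ((Par(c := Var 0)) p)) :: ('f, 'a) tm) = (\<lambda>p. Par (if p = c then y else p))"
      by auto
    then show ?thesis
      unfolding swap_def at_def
      using that holds_at_plug[OF \<theta>(1), of "Par a" M y "Par(c := Var 0)"] by auto
  qed
  \<comment> \<open>\<open>d\<close> supplies the elements imitating \<open>c\<close>. Restricting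
    it to solutions of \<open>swap b\<close> means that \<open>b\<close> satisfies every
    \<open>at (d i)\<close>, so that the next \<open>a\<close> can be found.\<close>
  have "\<exists>d a :: nat \<Rightarrow> 'a. range d \<subseteq> {y \<in> ?G. holds_at M (swap b) y} \<and> range a \<subseteq> ?G \<and>
    inj d \<and> inj a \<and> (\<forall>i j. j < i \<longrightarrow> \<not> holds_at M (at (d i)) (a j)) \<and>
    (\<forall>i j. i \<le> j \<longrightarrow> holds_at M (at (d i)) (a j))"
  proof (rule alternating_sequences[of "{y \<in> ?G. holds_at M (swap b) y}" ?G
        "\<lambda>y x. \<not> holds_at M (at y) x" "\<lambda>y x. holds_at M (at y) x"])
    fix X Y assume XY: "finite X" "finite Y" "X \<subseteq> {y \<in> ?G. holds_at M (swap b) y}" "Y \<subseteq> ?G"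
    let ?S = "insert (swap b) ((\<lambda>a. Neg (swap a)) ` Y)"
    have neg: "holds_at M (Neg (swap a)) y \<longleftrightarrow> \<not> holds_at M (at y) a" if "a \<in> ?G" for a y
      using swap[of a y] that GsubM by (auto simp: holds_at_def)
    have "Neg (swap a) \<in> fm1 L (insert b ?G)" if "a \<in> ?G" for a
      using swap_fm1[of a] that by (auto simp: fm1_def insert_absorb intro: fm_over_mono)
    then have "?S \<subseteq> fm1 L (insert b ?G)"
      using XY swap_fm1[of b] by auto
    \<comment> \<open>The negations hold at \<open>c\<close> because no element of \<open>G\<close>
      satisfies \<open>\<theta>\<close>, which is \<open>at c\<close>.\<close>
    moreover have "\<forall>\<psi>\<in>?S. holds_at M \<psi> c"
      using neg XY \<theta>(2) no b by (auto simp: swap at_c)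
    ultimately have "\<exists>y\<in>?G - X. \<forall>\<psi>\<in>?S. holds_at M \<psi> y"
      using XY c by (intro finitely_satisfiable_tpD[OF fs]) auto
    then show "\<exists>y\<in>{y \<in> ?G. holds_at M (swap b) y} - X. \<forall>x\<in>Y. \<not> holds_at M (at y) x"
      using neg XY(4) by blast
  next
    fix X Y assume XY: "finite X" "finite Y" "X \<subseteq> {y \<in> ?G. holds_at M (swap b) y}" "Y \<subseteq> ?G"
    \<comment> \<open>Here \<open>b\<close> is imitated over \<open>G\<close> alone, which
      elementarity permits.\<close>
    have "\<exists>x\<in>?G - Y. \<forall>\<psi>\<in>at ` X. holds_at M \<psi> x"
      using XY b at_fm1 swap
      by (intro finitely_satisfiable_tpD[OF elem_ext_finitely_satisfiable[OF GM, of b]]) auto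
    then show "\<exists>x\<in>?G - Y. \<forall>y\<in>X. holds_at M (at y) x" by auto
  qed
  then obtain d a :: "nat \<Rightarrow> 'a"
    where "range d \<subseteq> {y \<in> ?G. holds_at M (swap b) y}" "range a \<subseteq> ?G"
      and 1: "\<forall>i j. j < i \<longrightarrow> \<not> holds_at M (at (d i)) (a j)"
      and 2: "\<forall>i j. i \<le> j \<longrightarrow> holds_at M (at (d i)) (a j)"
    by blast
  then have d: "d i \<in> ?G" and a: "a i \<in> ?G" for i by auto
  \<comment> \<open>Stability concerns formulas without parameters, so the finitely many parameters
    of \<open>\<theta>\<close> become variables, with their values moved into the second
    tuple.\<close>
  obtain F where F: "finite F" "F \<subseteq> insert c ?G" "fm_over L F \<theta>"
    using \<theta>(1) fm_over_finite[of L "insert c ?G" \<theta>] by (auto simp: fm1_def)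
  obtain ps where ps: "set ps = F"
    using F(1) finite_list by auto
  then have "\<forall>p\<in>F. \<exists>i. i < length ps \<and> ps ! i = p"
    by (auto simp: in_set_conv_nth)
  then obtain idx where idx: "\<And>p. p \<in> F \<Longrightarrow> idx p < length ps \<and> ps ! idx p = p"
    by metis
  \<comment> \<open>\<open>Var 0\<close> keeps its name, the variables \<open>1, ..., length ps\<close> replace the parameters \<open>ps\<close>.\<close>
  define K where "K = Suc (length ps)"
  \<comment> \<open>All variables except \<open>Var 0\<close> move beyond \<open>length ps\<close>,
    so that the quantifiers of \<open>\<theta>\<close> capture none of the new variables.\<close>
  define \<rho> where "\<rho> n = (if n = 0 then 0 else n + K)" for n :: nat
  define \<sigma> :: "'a \<Rightarrow> ('f, 'a) tm" where "\<sigma> p = Var (Suc (idx p))" for p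
  \<comment> \<open>Only the entries equal to \<open>c\<close> depend on \<open>j\<close>; the
    others are fixed elements of \<open>G\<close>.\<close>
  define tup where "tup j = map (\<lambda>p. if p = c then d j else p) ps" for j
  have \<rho>: "inj \<rho>"
    by (auto simp: \<rho>_def inj_def)
  \<comment> \<open>On these tuples \<open>tr \<rho> \<sigma> \<theta>\<close> expresses
    \<open>j \<le> i\<close>, and the order property asks for \<open>i < j\<close>, hence the
    negation.\<close>
  have "order_property G (Neg (tr \<rho> \<sigma> \<theta>)) 1 (length ps)"
    unfolding order_property_def
  proof (intro exI conjI allI)
    fix i j
    let ?e = "nth ([a i] @ tup j)"
    have "sat G ?e (tr \<rho> \<sigma> \<theta>) \<longleftrightarrow> sat G (\<lambda>n. ?e (\<rho> n)) (tr (\<lambda>n. n) (\<lambda>p. Par (tm_val G ?e (\<sigma> p))) \<theta>)"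
      using F(3) idx by (intro sat_tr[OF \<rho>]) (force simp: \<sigma>_def \<rho>_def K_def)+
    also have "tr (\<lambda>n. n) (\<lambda>p. Par (tm_val G ?e (\<sigma> p))) \<theta> = at (d j)"
      unfolding at_def using idx by (intro tr_cong[OF F(3)]) (auto simp: \<sigma>_def tup_def)
    also have "sat G (\<lambda>n. ?e (\<rho> n)) (at (d j)) \<longleftrightarrow> holds_at G (at (d j)) (a i)"
      unfolding holds_at_def using at_fm1[OF d[of j]]
      by (intro sat_cong) (auto simp: fm1_def \<rho>_def)
    also have "\<dots> \<longleftrightarrow> j \<le> i"
      using elem_ext_holds_at[OF GM at_fm1[OF d[of j]] a[of i]] 1 2 by (cases "j \<le> i") auto
    finally show "sat G ?e (Neg (tr \<rho> \<sigma> \<theta>)) \<longleftrightarrow> i < j" by auto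
  qed (use F(2) ps a d in \<open>auto simp: tup_def\<close>)
  moreover have "is_model L G (Th L G)"
    using struct by (auto simp: is_model_def Th_def)
  moreover have "fm_over L {} (Neg (tr \<rho> \<sigma> \<theta>))"
    using F(3) by (auto simp: \<sigma>_def intro: fm_over_tr)
  moreover have "free_vars (Neg (tr \<rho> \<sigma> \<theta>)) \<subseteq> {..<1 + length ps}"
    using free_vars_tr[OF F(3), of \<rho> \<sigma>] \<theta>(1) idx by (fastforce simp: fm1_def \<sigma>_def \<rho>_def)
  ultimately show False
    using stable unfolding stable_theory_def by blast
qed


section \<open>Product sets\<close>

text \<open>Types are in one variable, so a condition on a product has to be read as a property of
  one factor with the other as a parameter.\<close>

definition mult_right :: "'f \<Rightarrow> ('f, 'r, 'a) fm \<Rightarrow> 'a \<Rightarrow> ('f, 'r, 'a) fm" where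
  "mult_right m \<phi> c = plug (App m [Var 0, Par c]) Par \<phi>"

definition mult_left :: "'f \<Rightarrow> ('f, 'r, 'a) fm \<Rightarrow> 'a \<Rightarrow> ('f, 'r, 'a) fm" where
  "mult_left m \<phi> b = plug (App m [Par b, Var 0]) Par \<phi>"

lemma mult_in_fm1:
  assumes "expands_group L m G" "\<phi> \<in> fm1 L A" "A \<subseteq> B" "c \<in> B"
  shows "mult_right m \<phi> c \<in> fm1 L B" "mult_left m \<phi> c \<in> fm1 L B"
  using assms unfolding mult_right_def mult_left_def expands_group_def
  by (auto intro!: plug_in_fm1[of \<phi> L A])

lemma holds_at_mult:
  assumes "expands_group L m G" "is_struct L M" "\<phi> \<in> fm1 L A" "b \<in> universe M" "c \<in> universe M"
  shows "holds_at M (mult_right m \<phi> c) b \<longleftrightarrow> holds_at M \<phi> (gmult M m b c)"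
    and "holds_at M (mult_left m \<phi> b) c \<longleftrightarrow> holds_at M \<phi> (gmult M m b c)"
proof -
  have "gmult M m b c \<in> universe M"
    using assms by (auto simp: expands_group_def is_struct_def)
  then show "holds_at M (mult_right m \<phi> c) b \<longleftrightarrow> holds_at M \<phi> (gmult M m b c)"
    and "holds_at M (mult_left m \<phi> b) c \<longleftrightarrow> holds_at M \<phi> (gmult M m b c)"
    unfolding mult_right_def mult_left_def
    by (simp_all add: holds_at_plug[OF assms(3)])
qed

lemma elem_ext_gmult:
  assumes "expands_group L m G" "elem_ext L G M" "b \<in> universe G" "c \<in> universe G"
  shows "gmult G m b c \<in> universe G" "gmult M m b c = gmult G m b c"
proof -
  show in_G: "gmult G m b c \<in> universe G"
    using assms by (auto simp: expands_group_def is_struct_def)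
  \<comment> \<open>The equation describing the product in \<open>G\<close> persists in
    \<open>M\<close> by elementarity.\<close>
  let ?\<psi> = "Eq (Var 0) (App m [Par b, Par c])"
  have "?\<psi> \<in> fm1 L (universe G)"
    using assms by (simp add: fm1_def expands_group_def)
  from elem_ext_holds_at[OF assms(2) this in_G]
  show "gmult M m b c = gmult G m b c"
    by (simp add: holds_at_def)
qed

section \<open>From coheirs to product sets\<close>

lemma coheir_substantial_imp_productset:
  fixes G M :: "('f, 'r, 'a) fo_struct"
  assumes grp: "expands_group L m G" and GM: "elem_ext L G M"
    and \<phi>: "\<phi> \<in> fm1 L (universe G)" and cs: "coheir_substantial L m G M \<phi>"
  shows "productset_property m G (solutions G \<phi>)"
proof -
  let ?G = "universe G"
  obtain b c where b: "b \<in> universe M - ?G" and c: "c \<in> universe M - ?G"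
    and bc: "holds_at M \<phi> (gmult M m b c)"
    and fsb: "finitely_satisfiable_in M (tp L M b (insert c ?G)) ?G"
    and fsc: "finitely_satisfiable_in M (tp L M c (insert b ?G)) ?G"
    using cs unfolding coheir_substantial_def by blast
  have GsubM: "?G \<subseteq> universe M" and struct: "is_struct L M"
    using GM by (auto simp: elem_ext_def)
  note mult = holds_at_mult[OF grp struct \<phi>]
  let ?R = "\<lambda>x y. holds_at M \<phi> (gmult M m x y)"
  \<comment> \<open>The side conditions are the invariant: \<open>b\<close> satisfies
    \<open>mult_right m \<phi> y\<close> for each chosen \<open>y\<close>, and \<open>c\<close>
    satisfies \<open>mult_left m \<phi> x\<close> for each chosen \<open>x\<close>, so the next
    imitation is always possible.\<close>
  have "\<exists>x y :: nat \<Rightarrow> 'a. range x \<subseteq> {x \<in> ?G. ?R x c} \<and> range y \<subseteq> {y \<in> ?G. ?R b y} \<and>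
    inj x \<and> inj y \<and> (\<forall>i j. j < i \<longrightarrow> ?R (x i) (y j)) \<and> (\<forall>i j. i \<le> j \<longrightarrow> ?R (x i) (y j))"
  proof (rule alternating_sequences[of "{x \<in> ?G. ?R x c}" "{y \<in> ?G. ?R b y}" ?R ?R])
    fix X Y assume XY: "finite X" "finite Y" "X \<subseteq> {x \<in> ?G. ?R x c}" "Y \<subseteq> {y \<in> ?G. ?R b y}"
    have in_M: "y \<in> universe M" if "y \<in> insert c Y" for y
      using that XY c GsubM by auto
    have "\<exists>x\<in>?G - X. \<forall>\<psi>\<in>mult_right m \<phi> ` insert c Y. holds_at M \<psi> x"
    proof (rule finitely_satisfiable_tpD[OF fsb])
      show "mult_right m \<phi> ` insert c Y \<subseteq> fm1 L (insert c ?G)"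
        using XY by (intro image_subsetI mult_in_fm1(1)[OF grp \<phi>]) auto
      show "\<forall>\<psi>\<in>mult_right m \<phi> ` insert c Y. holds_at M \<psi> b"
        using XY b bc in_M by (auto simp: mult(1))
    qed (use b XY in auto)
    then obtain x where "x \<in> ?G - X" "\<And>y. y \<in> insert c Y \<Longrightarrow> holds_at M (mult_right m \<phi> y) x"
      by blast
    then show "\<exists>x\<in>{x \<in> ?G. ?R x c} - X. \<forall>y\<in>Y. ?R x y"
      using in_M GsubM mult(1) by (intro bexI[of _ x]) blast+
  next
    fix X Y assume XY: "finite X" "finite Y" "X \<subseteq> {x \<in> ?G. ?R x c}" "Y \<subseteq> {y \<in> ?G. ?R b y}"
    have in_M: "x \<in> universe M" if "x \<in> insert b X" for x
      using that XY b GsubM by auto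
    have "\<exists>y\<in>?G - Y. \<forall>\<psi>\<in>mult_left m \<phi> ` insert b X. holds_at M \<psi> y"
    proof (rule finitely_satisfiable_tpD[OF fsc])
      show "mult_left m \<phi> ` insert b X \<subseteq> fm1 L (insert b ?G)"
        using XY by (intro image_subsetI mult_in_fm1(2)[OF grp \<phi>]) auto
      show "\<forall>\<psi>\<in>mult_left m \<phi> ` insert b X. holds_at M \<psi> c"
        using XY c bc in_M by (auto simp: mult(2))
    qed (use c XY in auto)
    then obtain y where "y \<in> ?G - Y" "\<And>x. x \<in> insert b X \<Longrightarrow> holds_at M (mult_left m \<phi> x) y"
      by blast
    then show "\<exists>y\<in>{y \<in> ?G. ?R b y} - Y. \<forall>x\<in>X. ?R x y"
      using in_M GsubM mult(2) by (intro bexI[of _ y]) blast+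
  qed
  then obtain x y :: "nat \<Rightarrow> 'a"
    where xy: "range x \<subseteq> {x \<in> ?G. ?R x c}" "range y \<subseteq> {y \<in> ?G. ?R b y}" "inj x" "inj y"
      and 1: "\<forall>i j. j < i \<longrightarrow> ?R (x i) (y j)" and 2: "\<forall>i j. i \<le> j \<longrightarrow> ?R (x i) (y j)"
    by blast
  have in_G: "x i \<in> ?G" "y i \<in> ?G" for i
    using xy by auto
  \<comment> \<open>Whichever of \<open>x i\<close> and \<open>y j\<close> was chosen later was
    chosen to fit the other.\<close>
  have "?R (x i) (y j)" for i j
    using 1 2 by (cases "i \<le> j") auto
  then have "holds_at M \<phi> (gmult G m (x i) (y j))" for i j
    using elem_ext_gmult(2)[OF grp GM in_G, of i j] by metis
  then have "gmult G m (x i) (y j) \<in> solutions G \<phi>" for i j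
    using elem_ext_gmult[OF grp GM in_G, of i j] elem_ext_holds_at[OF GM \<phi>]
    unfolding solutions_def by simp
  then have "{gmult G m b c |b c. b \<in> range x \<and> c \<in> range y} \<subseteq> solutions G \<phi>"
    by auto
  moreover have "infinite (range x)" "infinite (range y)"
    using xy by (auto simp: finite_image_iff)
  moreover have "range x \<subseteq> ?G" "range y \<subseteq> ?G"
    using in_G by auto
  ultimately show ?thesis
    unfolding productset_property_def by (intro exI[of _ "range x"] exI[of _ "range y"] conjI)
qed

section \<open>From product sets to coheirs in the stable case\<close>

text \<open>
  This partial type does the work of a nonprincipal ultrafilter on \<open>C\<close>: any realization has
  type finitely satisfiable in \<open>C\<close>, because the negation of a formula without solutions in \<open>C\<close>
  belongs to it.
\<close>

definition cofinite_type ::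
    "('f, 'r) language \<Rightarrow> ('f, 'r, 'a) fo_struct \<Rightarrow> 'a set \<Rightarrow> 'a set \<Rightarrow> ('f, 'r, 'a) fm set" where
  "cofinite_type L M C A = {\<psi> \<in> fm1 L A. finite {y \<in> C. \<not> holds_at M \<psi> y}}"

lemma cofinite_typeI:
  assumes "\<psi> \<in> fm1 L A" "\<And>y. y \<in> C \<Longrightarrow> holds_at M \<psi> y"
  shows "\<psi> \<in> cofinite_type L M C A"
proof -
  have "{y \<in> C. \<not> holds_at M \<psi> y} = {}"
    using assms(2) by blast
  then show ?thesis
    unfolding cofinite_type_def using assms(1) finite.emptyI by (metis (mono_tags) mem_Collect_eq)
qed

text \<open>The inequality fails at \<open>g\<close> at most. Hence every realization of the type
  lies outside \<open>A\<close>.\<close>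

lemma neq_in_cofinite_type:
  assumes "g \<in> A"
  shows "Neg (Eq (Var 0) (Par g)) \<in> cofinite_type L M C A"
proof -
  have "finite {y \<in> C. \<not> holds_at M (Neg (Eq (Var 0) (Par g))) y}"
    by (rule finite_subset[of _ "{g}"]) auto
  then show ?thesis
    using assms by (simp add: cofinite_type_def)
qed

text \<open>Finitely many members of the type fail together at only finitely many points of
  \<open>C\<close>, so the infinite set \<open>C\<close> contains a common solution and saturation
  applies.\<close>

lemma cofinite_type_realized:
  assumes "saturated \<kappa> L M" "A \<subseteq> universe M" "|A| <o \<kappa>" "C \<subseteq> universe M" "infinite C"
  shows "\<exists>c\<in>universe M. (\<forall>\<psi>\<in>cofinite_type L M C A. holds_at M \<psi> c) \<and>
    finitely_satisfiable_in M (tp L M c A) C"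
proof -
  have "\<exists>a\<in>universe M. \<forall>\<psi>\<in>q. holds_at M \<psi> a" if q: "finite q" "q \<subseteq> cofinite_type L M C A" for q
  proof -
    have "finite (\<Union>\<psi>\<in>q. {y \<in> C. \<not> holds_at M \<psi> y})"
      using q by (auto simp: cofinite_type_def)
    then have "\<not> C \<subseteq> (\<Union>\<psi>\<in>q. {y \<in> C. \<not> holds_at M \<psi> y})"
      using assms(5) finite_subset by blast
    then obtain y where "y \<in> C" "y \<notin> (\<Union>\<psi>\<in>q. {y \<in> C. \<not> holds_at M \<psi> y})"
      by blast
    then show ?thesis
      using assms(4) by auto
  qed
  moreover have "cofinite_type L M C A \<subseteq> fm1 L A"
    by (auto simp: cofinite_type_def)
  ultimately obtain c where c: "c \<in> universe M" "\<forall>\<psi>\<in>cofinite_type L M C A. holds_at M \<psi> c"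
    using assms(1)[unfolded saturated_def, rule_format, of A "cofinite_type L M C A"] assms(2,3)
    by blast
  have "\<exists>y\<in>C. holds_at M \<psi> y" if "\<psi> \<in> tp L M c A" for \<psi>
  proof (rule ccontr)
    assume "\<not> ?thesis"
    then have "Neg \<psi> \<in> cofinite_type L M C A"
      using that by (intro cofinite_typeI) (auto simp: tp_def fm1_def holds_at_def)
    with c(2) have "holds_at M (Neg \<psi>) c" ..
    then show False
      using that by (simp add: tp_def holds_at_def)
  qed
  then show ?thesis
    using c unfolding finitely_satisfiable_in_def by blast
qed

lemma productset_imp_coheir_substantial:
  fixes G M :: "('f, 'r, 'a) fo_struct"
  assumes grp: "expands_group L m G" and GM: "elem_ext L G M"
    and cinf: "Cinfinite \<kappa>" and card: "|universe G| <o \<kappa>" and sat: "saturated \<kappa> L M"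
    and \<phi>: "\<phi> \<in> fm1 L (universe G)" and stable: "stable_theory L (Th L G)"
    and prod: "productset_property m G (solutions G \<phi>)"
  shows "coheir_substantial L m G M \<phi>"
proof -
  let ?G = "universe G"
  obtain B C where B: "B \<subseteq> ?G" "infinite B" and C: "C \<subseteq> ?G" "infinite C"
    and BC: "{gmult G m b c |b c. b \<in> B \<and> c \<in> C} \<subseteq> solutions G \<phi>"
    using prod unfolding productset_property_def by blast
  have GsubM: "?G \<subseteq> universe M" and struct: "is_struct L M"
    using GM by (auto simp: elem_ext_def)
  note mult = holds_at_mult[OF grp struct \<phi>]
  have BCM: "holds_at M \<phi> (gmult M m x y)" if "x \<in> B" "y \<in> C" for x y
  proof -
    have "x \<in> ?G" "y \<in> ?G"
      using that B C by auto
    moreover have "gmult G m x y \<in> solutions G \<phi>"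
      using that BC by blast
    ultimately show ?thesis
      using elem_ext_gmult[OF grp GM] elem_ext_holds_at[OF GM \<phi>] by (auto simp: solutions_def)
  qed
  obtain b where b: "b \<in> universe M" "\<forall>\<psi>\<in>cofinite_type L M B ?G. holds_at M \<psi> b"
    using cofinite_type_realized[OF sat GsubM card, of B] B GsubM by blast
  \<comment> \<open>If \<open>b\<close> were in \<open>G\<close>, the type it realizes would contain
    the formula saying that \<open>x\<close> differs from \<open>b\<close>.\<close>
  have b_notin: "b \<notin> ?G"
    using b(2)[rule_format, OF neq_in_cofinite_type, of b] by auto
  have b_mult: "holds_at M \<phi> (gmult M m b y)" if y: "y \<in> C" for y
  proof -
    have yM: "y \<in> ?G" "y \<in> universe M"
      using y C GsubM by auto
    have "mult_right m \<phi> y \<in> cofinite_type L M B ?G"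
    proof (rule cofinite_typeI)
      show "mult_right m \<phi> y \<in> fm1 L ?G"
        using mult_in_fm1(1)[OF grp \<phi> order_refl yM(1)] .
      show "holds_at M (mult_right m \<phi> y) x" if "x \<in> B" for x
        using BCM[OF that y] mult(1)[of x y] that B GsubM yM(2) by auto
    qed
    with b(2) have "holds_at M (mult_right m \<phi> y) b" ..
    then show ?thesis
      using mult(1)[OF b(1) yM(2)] by simp
  qed
  \<comment> \<open>A singleton is no larger than the nonempty \<open>G\<close>, and
    \<open>\<kappa>\<close> is infinite, so saturation is still available after adding the parameter
    \<open>b\<close>.\<close>
  have "?G \<noteq> {}"
    using B by auto
  then have "|{b}| <o \<kappa>"
    by (rule ordLeq_ordLess_trans[OF card_of_singl_ordLeq card])
  then have card': "|insert b ?G| <o \<kappa>"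
    using Un_Cinfinite_bound_strict[of "{b}" \<kappa> ?G] card cinf by simp
  have "insert b ?G \<subseteq> universe M" "C \<subseteq> universe M"
    using b(1) C GsubM by auto
  then obtain c where c: "c \<in> universe M"
    "\<forall>\<psi>\<in>cofinite_type L M C (insert b ?G). holds_at M \<psi> c"
    "finitely_satisfiable_in M (tp L M c (insert b ?G)) C"
    using cofinite_type_realized[OF sat _ card' _ C(2)] by blast
  have c_notin: "c \<notin> ?G"
    using c(2)[rule_format, OF neq_in_cofinite_type, of c] by auto
  have "mult_left m \<phi> b \<in> cofinite_type L M C (insert b ?G)"
  proof (rule cofinite_typeI)
    show "mult_left m \<phi> b \<in> fm1 L (insert b ?G)"
      by (rule mult_in_fm1(2)[OF grp \<phi>]) auto
    show "holds_at M (mult_left m \<phi> b) y" if "y \<in> C" for y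
      using b_mult[OF that] mult(2)[of b y] b(1) that C GsubM by auto
  qed
  with c(2) have "holds_at M (mult_left m \<phi> b) c" ..
  then have bc: "holds_at M \<phi> (gmult M m b c)"
    using mult(2)[OF b(1) c(1)] by simp
  have fsc: "finitely_satisfiable_in M (tp L M c (insert b ?G)) ?G"
    using c(3) C(1) unfolding finitely_satisfiable_in_def by blast
  \<comment> \<open>Since \<open>b\<close> was chosen over \<open>G\<close> before \<open>c\<close>,
    its type over \<open>G\<close> and \<open>c\<close> is only controlled through symmetry.\<close>
  have "finitely_satisfiable_in M (tp L M b (insert c ?G)) ?G"
    using b(1) b_notin c(1) c_notin by (intro stable_coheir_symmetric[OF GM stable _ _ fsc]) auto
  then show ?thesis
    unfolding coheir_substantial_def using b(1) b_notin c(1) c_notin bc fsc by blast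
qed

theorem theorem3p7:
  fixes L :: "('f, 'r) language"
    and m :: 'f
    and G M :: "('f, 'r, 'a) fo_struct"
    and \<kappa> :: "'k rel"
    and \<phi> :: "('f, 'r, 'a) fm"
  assumes "expands_group L m G"
    and "elem_ext L G M"
    and "Cinfinite \<kappa>"
    and "|universe G| <o \<kappa>"
    and "saturated \<kappa> L M"
    and "\<phi> \<in> fm1 L (universe G)"
  shows "(coheir_substantial L m G M \<phi> \<longrightarrow> productset_property m G (solutions G \<phi>)) \<and>
    (stable_theory L (Th L G) \<longrightarrow>
       (coheir_substantial L m G M \<phi> \<longleftrightarrow> productset_property m G (solutions G \<phi>)))"
  using coheir_substantial_imp_productset[OF assms(1,2,6)]
    productset_imp_coheir_substantial[OF assms(1-6)] by blast

end
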